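(* Let $G_1$ be an $r_1$-regular graph on $n_1$ vertices and $m_1$ edges, and $G_2$ an arbitrary graph on $n_2$ vertices. Then $$\phi(L(G_1 \ominus G_2); x) = (x^2-(3+n_2)x+2)^{m_1-n_1} \cdot \prod_{i=2}^{n_2} (x-1-\mu_i(G_2))^{m_1} \cdot \prod_{i=1}^{n_1} \left( x^3 - (3+r_1+n_2)x^2 + (2+r_1+r_1n_2+\mu_i(G_1))x - \mu_i(G_1) \right).$$
   Context: All graphs are finite, simple and undirected. For a graph $G$, $A(G)$ is its adjacency matrix, $D(G)$ the diagonal matrix of degrees, $L(G)=D(G)-A(G)$ its Laplacian matrix; $\phi(M;x)=\det(xI-M)$. The Laplacian eigenvalues of a graph $G$ on $n$ vertices are $0=\mu_1(G)\le\dots\le\mu_n(G)$. The subdivision graph $\mathcal{S}(G)$ is obtained from $G$ by inserting a new vertex into every edge of $G$; $I(G)$ denotes the set of these inserted vertices. The subdivision-edge corona $G_1\ominus G_2$ of two vertex-disjoint graphs is the graph obtained from $\mathcal{S}(G_1)$ and $|I(G_1)|$ copies of $G_2$, all vertex-disjoint, by joining the $i$th vertex of $I(G_1)$ to every vertex in the $i$th copy of $G_2$. *)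

theory Defs
  imports
    "Graph_Theory.Pair_Digraph"
    "Jordan_Normal_Form.Char_Poly"
    "HOL-Computational_Algebra.Polynomial_Factorial"
begin

text \<open>
  A finite simple undirected graph is a \<^const>\<open>pair_graph\<close>: a finite, loop-free, symmetric
  digraph without parallel arcs. Each undirected edge is represented by two opposite arcs, so
  undirected edges are the two-element sets of end points, and the degree of a vertex is its
  \<^const>\<open>out_degree\<close>.
\<close>

definition uedges :: "'a pair_pre_digraph \<Rightarrow> 'a set set" where
  "uedges G = {{u, v} | u v. (u, v) \<in> parcs G}"

definition regular_graph :: "nat \<Rightarrow> 'a pair_pre_digraph \<Rightarrow> bool" where
  "regular_graph r G \<longleftrightarrow> (\<forall>v \<in> pverts G. out_degree (with_proj G) v = r)"

definition enumerates :: "'a list \<Rightarrow> 'a pair_pre_digraph \<Rightarrow> bool" where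
  "enumerates vs G \<longleftrightarrow> distinct vs \<and> set vs = pverts G"

text \<open>
  Matrices are indexed by \<open>0..<length vs\<close>, where \<open>vs\<close> enumerates the vertices of \<open>G\<close>.
\<close>

definition adjacency_mat :: "'a list \<Rightarrow> 'a pair_pre_digraph \<Rightarrow> real mat" where
  "adjacency_mat vs G = mat (length vs) (length vs)
     (\<lambda>(i, j). if (vs ! i, vs ! j) \<in> parcs G then 1 else 0)"

definition degree_mat :: "'a list \<Rightarrow> 'a pair_pre_digraph \<Rightarrow> real mat" where
  "degree_mat vs G = mat (length vs) (length vs)
     (\<lambda>(i, j). if i = j then real (out_degree (with_proj G) (vs ! i)) else 0)"

definition laplacian_mat :: "'a list \<Rightarrow> 'a pair_pre_digraph \<Rightarrow> real mat" where
  "laplacian_mat vs G = degree_mat vs G - adjacency_mat vs G"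

text \<open>
  \<open>laplacian_eig vs G i\<close> is the \<open>i\<close>-th smallest Laplacian eigenvalue, \<open>i\<close> counting from 1;
  eigenvalues are repeated according to their multiplicity as roots of the characteristic
  polynomial.
\<close>

definition laplacian_eig :: "'a list \<Rightarrow> 'a pair_pre_digraph \<Rightarrow> nat \<Rightarrow> real" where
  "laplacian_eig vs G i =
     sorted_list_of_multiset (proots (char_poly (laplacian_mat vs G))) ! (i - 1)"

text \<open>
  In the subdivision graph, \<open>Inl v\<close> is the old vertex \<open>v\<close> and \<open>Inr e\<close> the vertex inserted into
  the edge \<open>e\<close>.
\<close>

definition inserted_vertices :: "'a pair_pre_digraph \<Rightarrow> ('a + 'a set) set" where
  "inserted_vertices G = Inr ` uedges G"

definition subdivision_graph :: "'a pair_pre_digraph \<Rightarrow> ('a + 'a set) pair_pre_digraph" where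
  "subdivision_graph G =
     \<lparr> pverts = Inl ` pverts G \<union> inserted_vertices G,
       parcs = {(Inl v, Inr e) | v e. e \<in> uedges G \<and> v \<in> e}
             \<union> {(Inr e, Inl v) | v e. e \<in> uedges G \<and> v \<in> e} \<rparr>"

text \<open>
  The copies of \<open>H\<close> are indexed by the inserted vertices of \<open>G\<close> themselves: \<open>Inr (w, u)\<close> is the
  vertex \<open>u\<close> in the copy of \<open>H\<close> belonging to the inserted vertex \<open>w\<close>. The sum type makes the
  subdivision graph and all copies vertex-disjoint.
\<close>

definition subdivision_edge_corona ::
  "'a pair_pre_digraph \<Rightarrow> 'b pair_pre_digraph \<Rightarrow>
     (('a + 'a set) + ('a + 'a set) \<times> 'b) pair_pre_digraph" where
  "subdivision_edge_corona G H =
     \<lparr> pverts = Inl ` pverts (subdivision_graph G) \<union> Inr ` (inserted_vertices G \<times> pverts H),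
       parcs = {(Inl a, Inl b) | a b. (a, b) \<in> parcs (subdivision_graph G)}
             \<union> {(Inr (w, u), Inr (w, v)) | w u v. w \<in> inserted_vertices G \<and> (u, v) \<in> parcs H}
             \<union> {(Inl w, Inr (w, u)) | w u. w \<in> inserted_vertices G \<and> u \<in> pverts H}
             \<union> {(Inr (w, u), Inl w) | w u. w \<in> inserted_vertices G \<and> u \<in> pverts H} \<rparr>"

lemma uedges_subset:
  assumes "pair_graph G" "e \<in> uedges G" "v \<in> e"
  shows "v \<in> pverts G"
proof -
  interpret pair_graph G by fact
  show ?thesis using assms(2,3) by (auto simp: uedges_def dest: in_arcsD1 in_arcsD2)
qed

lemma pair_graphI:
  assumes "finite (pverts G)" "parcs G \<subseteq> pverts G \<times> pverts G" "sym (parcs G)" "irrefl (parcs G)"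
  shows "pair_graph G"
proof
  show "finite (parcs G)" using assms(1,2) by (meson finite_SigmaI finite_subset)
qed (use assms in \<open>auto simp: symmetric_def irrefl_def\<close>)

lemma finite_uedges:
  assumes "pair_graph G"
  shows "finite (uedges G)"
proof -
  interpret pair_graph G by fact
  have "uedges G = (\<lambda>(u, v). {u, v}) ` parcs G" by (auto simp: uedges_def image_iff)
  then show ?thesis using pair_finite_arcs by simp
qed

lemma pair_graph_subdivision_graph:
  assumes "pair_graph G"
  shows "pair_graph (subdivision_graph G)"
proof (rule pair_graphI)
  interpret pair_graph G by fact
  show "finite (pverts (subdivision_graph G))"
    using finite_uedges[OF assms] pair_finite_verts
    by (simp add: subdivision_graph_def inserted_vertices_def)
qed (use uedges_subset[OF assms] in
      \<open>auto simp: subdivision_graph_def inserted_vertices_def sym_def irrefl_def\<close>)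

lemma pair_graph_subdivision_edge_corona:
  assumes "pair_graph G" "pair_graph H"
  shows "pair_graph (subdivision_edge_corona G H)"
proof (rule pair_graphI)
  interpret S: pair_graph "subdivision_graph G"
    by (rule pair_graph_subdivision_graph) fact
  interpret H: pair_graph H by fact
  have I: "inserted_vertices G \<subseteq> pverts (subdivision_graph G)"
    by (simp add: subdivision_graph_def)
  have "finite (inserted_vertices G)" using I S.pair_finite_verts by (rule finite_subset)
  then show "finite (pverts (subdivision_edge_corona G H))"
    using S.pair_finite_verts H.pair_finite_verts by (simp add: subdivision_edge_corona_def)
  show "parcs (subdivision_edge_corona G H) \<subseteq>
      pverts (subdivision_edge_corona G H) \<times> pverts (subdivision_edge_corona G H)"
    using I by (auto simp: subdivision_edge_corona_def dest: S.in_arcsD1 S.in_arcsD2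
        H.in_arcsD1 H.in_arcsD2)
  have "sym (parcs (subdivision_graph G))" "sym (parcs H)"
    using S.pair_sym_arcs H.pair_sym_arcs by (simp_all add: symmetric_def)
  then show "sym (parcs (subdivision_edge_corona G H))"
    by (auto simp: subdivision_edge_corona_def sym_def)
  show "irrefl (parcs (subdivision_edge_corona G H))"
    using S.pair_no_loops H.pair_no_loops
    by (fastforce simp: subdivision_edge_corona_def irrefl_def)
qed

end

theory Submission
  imports Defs
begin

text \<open>
  Order the vertices of the corona as old vertices, inserted vertices, copies of \<open>G\<^sub>2\<close>, and compute
  over the field of rational functions. Since every row of \<open>L(G\<^sub>2)\<close> sums to 0, subtracting
  \<open>1 / (x - 1)\<close> times the columns of a copy from the column of its inserted vertex clears the copy
  block, and turns the diagonal entry \<open>x - 2 - n\<^sub>2\<close> of an inserted vertex into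
  \<open>c = x - 2 - n\<^sub>2 - n\<^sub>2 / (x - 1)\<close>, where \<open>c (x - 1) = x\<^sup>2 - (3 + n\<^sub>2) x + 2\<close>. Clearing the inserted
  vertices next leaves \<open>(x - r\<^sub>1) I - R R\<^sup>T / c\<close> with the incidence matrix \<open>R\<close>, and by regularity
  \<open>R R\<^sup>T = 2 r\<^sub>1 I - L(G\<^sub>1)\<close>. It remains to evaluate the characteristic polynomials of \<open>L(G\<^sub>1)\<close> and
  \<open>L(G\<^sub>2)\<close>, which split over the reals with nonnegative roots since Laplacians are positive
  semidefinite; the smallest root for \<open>G\<^sub>2\<close> is 0.
\<close>

section \<open>Determinants indexed by finite sets\<close>

text \<open>Rows and columns carry labels instead of positions, so that matrix identities can be
  proved as identities between functions on vertices and edges.\<close>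

definition list_mat :: "'a list \<Rightarrow> 'b list \<Rightarrow> ('a \<Rightarrow> 'b \<Rightarrow> 'k) \<Rightarrow> 'k mat" where
  "list_mat rs cs f = mat (length rs) (length cs) (\<lambda>(i, j). f (rs ! i) (cs ! j))"

lemma list_mat_carrier [simp]: "list_mat rs cs f \<in> carrier_mat (length rs) (length cs)"
  by (simp add: list_mat_def)

lemma list_mat_cong:
  assumes "\<And>a b. a \<in> set rs \<Longrightarrow> b \<in> set cs \<Longrightarrow> f a b = g a b"
  shows "list_mat rs cs f = list_mat rs cs g"
  using assms by (auto simp: list_mat_def intro!: eq_matI)

lemma list_mat_mult:
  fixes f :: "'a \<Rightarrow> 'b \<Rightarrow> 'k :: semiring_0"
  assumes "distinct ks"
  shows "list_mat rs ks f * list_mat ks cs g =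
    list_mat rs cs (\<lambda>a b. \<Sum>k\<in>set ks. f a k * g k b)"
proof (rule eq_matI)
  fix i j
  assume "i < dim_row (list_mat rs cs (\<lambda>a b. \<Sum>k\<in>set ks. f a k * g k b))"
    and "j < dim_col (list_mat rs cs (\<lambda>a b. \<Sum>k\<in>set ks. f a k * g k b))"
  then have ij: "i < length rs" "j < length cs" by (simp_all add: list_mat_def)
  have "bij_betw (nth ks) {0..<length ks} (set ks)"
    using assms by (intro bij_betw_nth) auto
  from sum.reindex_bij_betw[OF this, of "\<lambda>k. f (rs ! i) k * g k (cs ! j)"] ij
  show "(list_mat rs ks f * list_mat ks cs g) $$ (i, j) =
    list_mat rs cs (\<lambda>a b. \<Sum>k\<in>set ks. f a k * g k b) $$ (i, j)"
    by (simp add: list_mat_def scalar_prod_def)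
qed (simp_all add: list_mat_def)

lemma list_mat_one:
  assumes "distinct vs"
  shows "list_mat vs vs (\<lambda>a b. if a = b then 1 else 0) = 1\<^sub>m (length vs)"
  using assms by (auto simp: list_mat_def nth_eq_iff_index_eq intro!: eq_matI)

text \<open>\<open>P\<close> and \<open>Q\<close> are the permutation matrices between the two
  enumerations. They satisfy \<open>det P * det Q = 1\<close>, and multiplying by them on either
  side reorders one matrix into the other.\<close>

lemma det_list_mat_set_cong:
  fixes f :: "'a \<Rightarrow> 'a \<Rightarrow> 'k :: comm_ring_1"
  assumes "distinct vs" "distinct ws" "set vs = set ws"
  shows "det (list_mat vs vs f) = det (list_mat ws ws f)"
proof -
  define d :: "'a \<Rightarrow> 'a \<Rightarrow> 'k" where "d = (\<lambda>a b. if a = b then 1 else 0)"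
  define P where "P = list_mat vs ws d"
  define Q where "Q = list_mat ws vs d"
  have len: "length vs = length ws"
    using assms by (metis distinct_card)
  have car: "P \<in> carrier_mat (length ws) (length ws)" "Q \<in> carrier_mat (length ws) (length ws)"
    "list_mat ws ws f \<in> carrier_mat (length ws) (length ws)"
    using list_mat_carrier[of vs ws d] list_mat_carrier[of ws vs d] len
    by (simp_all add: P_def Q_def)
  have "P * Q = list_mat vs vs d"
    unfolding P_def Q_def list_mat_mult[OF assms(2)]
    by (rule list_mat_cong) (use assms(3) in \<open>simp add: d_def if_distrib[of "\<lambda>x. x * _"] cong: if_cong\<close>)
  then have PQ: "det P * det Q = 1"
    using det_mult[OF car(1,2)] list_mat_one[OF assms(1)] det_one
    unfolding d_def by metis
  have "P * list_mat ws ws f * Q = list_mat vs vs f"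
    unfolding P_def Q_def list_mat_mult[OF assms(2)]
    by (rule list_mat_cong) (use assms(3) in \<open>simp add: d_def if_distrib[of "\<lambda>x. x * _"]
      if_distrib[of "\<lambda>x. _ * x"] cong: if_cong\<close>)
  then have "det (list_mat vs vs f) = det P * det (list_mat ws ws f) * det Q"
    using det_mult[OF car(1,3)] det_mult[OF mult_carrier_mat[OF car(1,3)] car(2)] by simp
  also have "\<dots> = det (list_mat ws ws f) * (det P * det Q)"
    by (simp add: ac_simps)
  finally show ?thesis using PQ by simp
qed

text \<open>
  By \<open>det_list_mat_set_cong\<close> the choice of the enumeration is irrelevant; for infinite \<open>S\<close> the value
  is junk.
\<close>

definition det_on :: "'a set \<Rightarrow> ('a \<Rightarrow> 'a \<Rightarrow> 'k :: comm_ring_1) \<Rightarrow> 'k" where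
  "det_on S f = (let vs = SOME vs. distinct vs \<and> set vs = S in det (list_mat vs vs f))"

lemma det_on_set:
  assumes "distinct vs"
  shows "det_on (set vs) f = det (list_mat vs vs f)"
proof -
  define ws where "ws = (SOME ws. distinct ws \<and> set ws = set vs)"
  have "distinct ws \<and> set ws = set vs"
    unfolding ws_def using assms by (rule_tac someI[where x = vs]) simp
  then show ?thesis
    using det_list_mat_set_cong[OF _ assms, of ws f] by (simp add: det_on_def ws_def[symmetric])
qed

lemma det_on_cong:
  assumes "finite S" "\<And>a b. a \<in> S \<Longrightarrow> b \<in> S \<Longrightarrow> f a b = g a b"
  shows "det_on S f = det_on S g"
proof -
  obtain vs where "distinct vs" "set vs = S"
    using finite_distinct_list[OF assms(1)] by blast
  then show ?thesis
    using det_on_set[of vs f] det_on_set[of vs g] list_mat_cong[of vs vs f g] assms(2) by auto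
qed

lemma det_on_mult:
  assumes "finite S"
  shows "det_on S f * det_on S g = det_on S (\<lambda>a b. \<Sum>k\<in>S. f a k * g k b)"
proof -
  obtain vs where vs: "distinct vs" "set vs = S"
    using finite_distinct_list[OF assms] by blast
  show ?thesis
    using det_mult[OF list_mat_carrier[of vs vs f] list_mat_carrier[of vs vs g]]
    by (simp add: det_on_set[OF vs(1)] list_mat_mult[OF vs(1)] flip: vs(2))
qed

lemma det_on_reindex:
  assumes "finite S" "inj_on h S"
  shows "det_on (h ` S) f = det_on S (\<lambda>a b. f (h a) (h b))"
proof -
  obtain vs where vs: "distinct vs" "set vs = S"
    using finite_distinct_list[OF assms(1)] by blast
  have "list_mat (map h vs) (map h vs) f = list_mat vs vs (\<lambda>a b. f (h a) (h b))"
    by (auto simp: list_mat_def intro!: eq_matI)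
  then show ?thesis
    using det_on_set[of "map h vs" f] det_on_set[of vs "\<lambda>a b. f (h a) (h b)"] vs assms(2)
    by (simp add: distinct_map)
qed

lemma det_on_empty [simp]: "det_on {} f = 1"
  using det_on_set[of "[]" f] det_dim_zero[OF list_mat_carrier[of "[]" "[]" f, simplified]] by simp

lemma det_on_singleton [simp]: "det_on {a} f = f a a"
  using det_on_set[of "[a]" f] by (simp add: list_mat_def det_single)

text \<open>Listing \<open>S\<close> before \<open>T\<close> makes the matrix block upper
  triangular.\<close>

lemma det_on_block:
  fixes f :: "'a \<Rightarrow> 'a \<Rightarrow> 'k :: idom"
  assumes "finite S" "finite T" "S \<inter> T = {}"
    and "\<And>a b. a \<in> T \<Longrightarrow> b \<in> S \<Longrightarrow> f a b = 0"
  shows "det_on (S \<union> T) f = det_on S f * det_on T f"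
proof -
  obtain vs ws where vs: "distinct vs" "set vs = S" and ws: "distinct ws" "set ws = T"
    using finite_distinct_list assms(1,2) by metis
  have z: "list_mat ws vs f = 0\<^sub>m (length ws) (length vs)"
    using assms(4) vs ws by (auto simp: list_mat_def intro!: eq_matI)
  have "list_mat (vs @ ws) (vs @ ws) f =
      four_block_mat (list_mat vs vs f) (list_mat vs ws f) (list_mat ws vs f) (list_mat ws ws f)"
    by (rule eq_matI) (auto simp: list_mat_def nth_append)
  then have "det (list_mat (vs @ ws) (vs @ ws) f) = det (list_mat vs vs f) * det (list_mat ws ws f)"
    using det_four_block_mat_lower_left_zero[OF list_mat_carrier list_mat_carrier z list_mat_carrier]
    by simp
  then show ?thesis
    using det_on_set[of "vs @ ws" f] det_on_set[of vs f] det_on_set[of ws f] vs ws assms(3) by simp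
qed

lemma det_on_diag:
  fixes d :: "'a \<Rightarrow> 'k :: idom"
  assumes "finite S"
  shows "det_on S (\<lambda>a b. if a = b then d a else 0) = prod d S"
  using assms
proof (induction S rule: finite_induct)
  case (insert a S)
  have "det_on ({a} \<union> S) (\<lambda>a b. if a = b then d a else 0) =
      det_on {a} (\<lambda>a b. if a = b then d a else 0) * det_on S (\<lambda>a b. if a = b then d a else 0)"
    by (rule det_on_block) (use insert in auto)
  then show ?case using insert by simp
qed simp

lemma det_on_scale:
  fixes f :: "'a \<Rightarrow> 'a \<Rightarrow> 'k :: idom"
  assumes "finite S"
  shows "det_on S (\<lambda>a b. c * f a b) = c ^ card S * det_on S f"
proof -
  have "c ^ card S * det_on S f = det_on S (\<lambda>a b. if a = b then c else 0) * det_on S f"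
    using det_on_diag[OF assms, of "\<lambda>_. c"] by simp
  also have "\<dots> = det_on S (\<lambda>a b. \<Sum>k\<in>S. (if a = k then c else 0) * f k b)"
    by (rule det_on_mult[OF assms])
  also have "\<dots> = det_on S (\<lambda>a b. c * f a b)"
    by (rule det_on_cong[OF assms])
       (simp add: assms if_distrib[of "\<lambda>x. x * _"] cong: if_cong)
  finally show ?thesis by simp
qed

text \<open>Distinct copies do not interact, so splitting off one copy of \<open>S\<close> at a time
  yields one factor \<open>det_on S g\<close> for each index.\<close>

lemma det_on_block_diag:
  fixes g :: "'b \<Rightarrow> 'b \<Rightarrow> 'k :: idom"
  assumes "finite I" "finite S"
  shows "det_on (I \<times> S) (\<lambda>p q. if fst p = fst q then g (snd p) (snd q) else 0) = det_on S g ^ card I"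
  using assms(1)
proof (induction I rule: finite_induct)
  case (insert i I)
  let ?f = "\<lambda>p q. if fst p = fst q then g (snd p) (snd q) else 0"
  have "det_on (insert i I \<times> S) ?f = det_on (Pair i ` S \<union> I \<times> S) ?f"
    by (rule arg_cong[where f = "\<lambda>X. det_on X ?f"]) auto
  also have "\<dots> = det_on (Pair i ` S) ?f * det_on (I \<times> S) ?f"
    by (rule det_on_block) (use insert assms(2) in auto)
  also have "det_on (Pair i ` S) ?f = det_on S g"
    using assms(2) by (subst det_on_reindex) (auto simp: inj_on_def)
  finally show ?case using insert by simp
qed simp

text \<open>
  A Schur complement that needs no inverse of the \<open>T\<close>-block: it suffices to have coefficients \<open>W\<close> with
  which the \<open>T\<close>-columns reproduce the lower left block.
\<close>

lemma det_on_schur: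
  fixes f :: "'a \<Rightarrow> 'a \<Rightarrow> 'k :: idom"
  assumes "finite S" "finite T" "S \<inter> T = {}"
    and W: "\<And>t s. t \<in> T \<Longrightarrow> s \<in> S \<Longrightarrow> f t s = (\<Sum>k\<in>T. f t k * W k s)"
  shows "det_on (S \<union> T) f = det_on S (\<lambda>a b. f a b - (\<Sum>k\<in>T. f a k * W k b)) * det_on T f"
proof -
  \<comment> \<open>\<open>U\<close> is the column operation subtracting from each
    \<open>S\<close>-column the combination of \<open>T\<close>-columns given by \<open>W\<close>.
    It is unit block triangular, hence of determinant 1, and by the assumption on \<open>W\<close>
    the product \<open>f U\<close> vanishes in the \<open>T\<close>-rows of the
    \<open>S\<close>-columns.\<close>
  define U where "U a b = (if a = b then 1 else if a \<in> T \<and> b \<in> S then - W a b else 0)" for a b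
  define h where "h a b = (\<Sum>k\<in>S \<union> T. f a k * U k b)" for a b
  have fin: "finite (T \<union> S)" "finite (S \<union> T)" using assms by auto
  have one: "det_on X U = 1" if "finite X" "X \<subseteq> S \<or> X \<subseteq> T" for X
  proof -
    have "det_on X U = det_on X (\<lambda>a b. if a = b then 1 else 0)"
      using that assms(3) by (intro det_on_cong) (auto simp: U_def)
    then show ?thesis using det_on_diag[OF that(1), of "\<lambda>_. 1 :: 'k"] by simp
  qed
  \<comment> \<open>The nonzero off-diagonal block of \<open>U\<close> has its rows in
    \<open>T\<close> and its columns in \<open>S\<close>, so \<open>T\<close> must be listed
    first.\<close>
  have "det_on (T \<union> S) U = det_on T U * det_on S U"
    using assms by (intro det_on_block) (auto simp: U_def)
  then have "det_on (S \<union> T) U = 1"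
    using one[of S] one[of T] assms by (simp add: Un_commute)
  then have "det_on (S \<union> T) f = det_on (S \<union> T) h"
    using det_on_mult[OF fin(2), of f U] by (simp add: h_def[abs_def])
  have hS: "h a b = f a b - (\<Sum>k\<in>T. f a k * W k b)" if "b \<in> S" for a b
  proof -
    have "(\<Sum>k\<in>S. f a k * U k b) = (\<Sum>k\<in>S. if k = b then f a k else 0)"
      using assms(3) by (intro sum.cong) (auto simp: U_def)
    moreover have "(\<Sum>k\<in>T. f a k * U k b) = (\<Sum>k\<in>T. - (f a k * W k b))"
      using assms(3) that by (intro sum.cong) (auto simp: U_def)
    ultimately show ?thesis
      using assms that by (simp add: h_def sum.union_disjoint sum_negf)
  qed
  have hT: "h a b = f a b" if "b \<in> T" for a b
  proof -
    have "h a b = (\<Sum>k\<in>S \<union> T. if k = b then f a k else 0)"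
      unfolding h_def using assms(3) that by (intro sum.cong) (auto simp: U_def)
    then show ?thesis using fin that by simp
  qed
  have "det_on (S \<union> T) h = det_on S h * det_on T h"
    using assms hS by (intro det_on_block) auto
  also have "det_on S h = det_on S (\<lambda>a b. f a b - (\<Sum>k\<in>T. f a k * W k b))"
    using assms hS by (intro det_on_cong) auto
  also have "det_on T h = det_on T f"
    using assms hT by (intro det_on_cong) auto
  finally show ?thesis using \<open>det_on (S \<union> T) f = det_on (S \<union> T) h\<close> by simp
qed

section \<open>Laplacian spectra\<close>

text \<open>The entries are integers, so one formula serves over the reals, the complex numbers and
  the rational functions.\<close>

definition lap :: "'a pair_pre_digraph \<Rightarrow> 'a \<Rightarrow> 'a \<Rightarrow> 'k :: comm_ring_1" where
  "lap G a b = (if a = b then of_nat (card {w. (a, w) \<in> parcs G}) else 0)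
     - (if (a, b) \<in> parcs G then 1 else 0)"

lemma out_degree_with_proj: "out_degree (with_proj G) v = card {w. (v, w) \<in> parcs G}"
proof -
  have "out_arcs (with_proj G) v = Pair v ` {w. (v, w) \<in> parcs G}"
    by (auto simp: out_arcs_def)
  then show ?thesis
    by (simp add: out_degree_def card_image inj_on_def)
qed

lemma laplacian_mat_eq_list_mat:
  assumes "distinct vs"
  shows "laplacian_mat vs G = list_mat vs vs (lap G)"
  using assms
  by (auto simp: laplacian_mat_def degree_mat_def adjacency_mat_def list_mat_def lap_def
      out_degree_with_proj nth_eq_iff_index_eq intro!: eq_matI)

text \<open>Determinants commute with ring homomorphisms, and these send the integer entries of a
  Laplacian to the same integers in the target. Below, \<open>\<phi>\<close> is the embedding into
  rational functions or an evaluation.\<close>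

lemma hom_char_poly_laplacian:
  fixes \<phi> :: "real poly \<Rightarrow> 'k :: comm_ring_1"
  assumes "comm_ring_hom \<phi>" "distinct vs"
  shows "\<phi> (char_poly (laplacian_mat vs G)) =
    det_on (set vs) (\<lambda>a b. (if a = b then \<phi> [:0, 1:] else 0) - lap G a b)"
proof -
  interpret comm_ring_hom \<phi> by fact
  have hom_lap: "\<phi> [:lap G a b:] = lap G a b" for a b
  proof -
    have "[:lap G a b:] = (if a = b then of_nat (card {w. (a, w) \<in> parcs G}) else 0)
        - (if (a, b) \<in> parcs G then 1 else (0 :: real poly))"
      by (simp add: lap_def of_nat_poly one_pCons)
    then show ?thesis
      by (simp add: lap_def hom_distribs)
  qed
  have hom_off: "\<phi> [:- lap G a b:] = - lap G a b" for a b
    using hom_uminus[of "[:lap G a b:]"] hom_lap[of a b] by simp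
  have hom_diag: "\<phi> (pCons (- lap G a b) 1) = \<phi> [:0, 1:] - lap G a b" for a b
    using hom_add[of "[:0, 1:]" "[:- lap G a b:]"] hom_off[of a b] by (simp add: one_pCons)
  have "map_mat \<phi> (char_poly_matrix (laplacian_mat vs G)) =
      list_mat vs vs (\<lambda>a b. (if a = b then \<phi> [:0, 1:] else 0) - lap G a b)"
    using assms(2)
    by (auto simp: laplacian_mat_eq_list_mat char_poly_matrix_def list_mat_def nth_eq_iff_index_eq
        hom_diag hom_off intro!: eq_matI)
  then show ?thesis
    unfolding char_poly_def det_on_set[OF assms(2)] by (metis hom_det)
qed

text \<open>Since the degree counts the neighbours, a Laplacian acts by summing differences along
  edges. A constant \<open>x\<close> shows that the rows sum to 0; in general this form leads to the
  quadratic form of the Laplacian.\<close>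

lemma lap_mult_vec:
  fixes x :: "'a \<Rightarrow> 'k :: comm_ring_1"
  assumes "pair_graph G" "u \<in> pverts G"
  shows "(\<Sum>w\<in>pverts G. lap G u w * x w) =
    (\<Sum>w\<in>pverts G. if (u, w) \<in> parcs G then x u - x w else 0)"
proof -
  interpret pair_graph G by fact
  have sub: "{w. (u, w) \<in> parcs G} = {w \<in> pverts G. (u, w) \<in> parcs G}"
    by (auto dest: in_arcsD2)
  have "of_nat (card {w. (u, w) \<in> parcs G}) = (\<Sum>w\<in>pverts G. if (u, w) \<in> parcs G then 1 else 0 :: 'k)"
    unfolding sub by (simp add: sum.If_cases Int_def)
  then have "(\<Sum>w\<in>pverts G. if (u, w) \<in> parcs G then x u else 0) =
      of_nat (card {w. (u, w) \<in> parcs G}) * x u"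
    by (simp add: sum_distrib_right if_distrib[of "\<lambda>y. y * _"] cong: if_cong)
  also have "\<dots> = (\<Sum>w\<in>pverts G.
      (if u = w then of_nat (card {w. (u, w) \<in> parcs G}) else 0) * x w)"
    using assms(2) by (simp add: if_distrib[of "\<lambda>y. y * _"] cong: if_cong)
  finally have "(\<Sum>w\<in>pverts G. lap G u w * x w) =
      (\<Sum>w\<in>pverts G. if (u, w) \<in> parcs G then x u else 0)
      - (\<Sum>w\<in>pverts G. (if (u, w) \<in> parcs G then 1 else 0) * x w)"
    by (simp add: lap_def left_diff_distrib sum_subtractf)
  also have "\<dots> = (\<Sum>w\<in>pverts G. if (u, w) \<in> parcs G then x u - x w else 0)"
    by (simp flip: sum_subtractf) (rule sum.cong; simp)
  finally show ?thesis .
qed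

text \<open>Pairing the eigenvector equation with \<open>cnj (x u)\<close> and symmetrising over
  both directions of each edge gives \<open>2 * z * N = Q\<close>, where \<open>N\<close> is the
  squared norm of \<open>x\<close> and \<open>Q\<close> a sum of squared moduli of differences along
  arcs. Realness and nonnegativity thus come out together.\<close>

lemma lap_eigenvalue_nonneg:
  fixes x :: "'a \<Rightarrow> complex"
  assumes "pair_graph G" "\<And>u. u \<in> pverts G \<Longrightarrow> (\<Sum>w\<in>pverts G. lap G u w * x w) = z * x u"
    and "v \<in> pverts G" "x v \<noteq> 0"
  shows "\<exists>c\<ge>0. z = complex_of_real c"
proof -
  interpret pair_graph G by fact
  let ?V = "pverts G"
  define a :: "'a \<Rightarrow> 'a \<Rightarrow> real" where "a u w = (if (u, w) \<in> parcs G then 1 else 0)" for u w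
  have sym: "a u w = a w u" for u w
    using pair_sym_arcs by (auto simp: a_def symmetric_def sym_def)
  define N where "N = (\<Sum>u\<in>?V. (cmod (x u))\<^sup>2)"
  have "0 < (cmod (x v))\<^sup>2" using assms(4) by simp
  also have "\<dots> \<le> N"
    unfolding N_def using assms(3) by (intro member_le_sum) auto
  finally have N: "N > 0" .
  have row: "(\<Sum>w\<in>?V. of_real (a u w) * (x u - x w)) = z * x u" if "u \<in> ?V" for u
    using assms(2)[OF that] lap_mult_vec[OF assms(1) that, of x]
    by (simp add: a_def if_distrib[of "\<lambda>y. y * _"] if_distrib[of complex_of_real] cong: if_cong)
  have 1: "(\<Sum>u\<in>?V. \<Sum>w\<in>?V. of_real (a u w) * (cnj (x u) * (x u - x w))) = z * of_real N"
  proof -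
    have "(\<Sum>u\<in>?V. \<Sum>w\<in>?V. of_real (a u w) * (cnj (x u) * (x u - x w))) =
        (\<Sum>u\<in>?V. cnj (x u) * (\<Sum>w\<in>?V. of_real (a u w) * (x u - x w)))"
      by (simp add: sum_distrib_left mult.left_commute)
    also have "\<dots> = (\<Sum>u\<in>?V. z * of_real ((cmod (x u))\<^sup>2))"
      unfolding complex_norm_square by (rule sum.cong) (simp_all add: row)
    finally show ?thesis by (simp add: N_def sum_distrib_left)
  qed
  \<comment> \<open>Exchanging the roles of \<open>u\<close> and \<open>w\<close> preserves the
    double sum because \<open>a\<close> is symmetric.\<close>
  have 2: "(\<Sum>u\<in>?V. \<Sum>w\<in>?V. of_real (a u w) * (cnj (x w) * (x w - x u))) = z * of_real N"
    by (subst 1[symmetric], subst sum.swap) (simp add: sym)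
  define Q where "Q = (\<Sum>u\<in>?V. \<Sum>w\<in>?V. a u w * (cmod (x u - x w))\<^sup>2)"
  have "2 * (z * of_real N) =
      (\<Sum>u\<in>?V. \<Sum>w\<in>?V. of_real (a u w) * (cnj (x u) * (x u - x w))
        + of_real (a u w) * (cnj (x w) * (x w - x u)))"
    using 1 2 by (simp add: sum.distrib)
  \<comment> \<open>This is the identity
    \<open>cnj p * (p - q) + cnj q * (q - p) = (p - q) * cnj (p - q)\<close>.\<close>
  also have "\<dots> = (\<Sum>u\<in>?V. \<Sum>w\<in>?V. of_real (a u w * (cmod (x u - x w))\<^sup>2))"
    unfolding of_real_mult complex_norm_square
    by (intro sum.cong refl) (simp add: algebra_simps)
  also have "\<dots> = of_real Q" by (simp add: Q_def)
  finally have "z = of_real (Q / (2 * N))"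
    using N by (simp add: field_simps)
  moreover have "Q \<ge> 0"
    unfolding Q_def by (intro sum_nonneg) (auto simp: a_def)
  ultimately show ?thesis using N by (intro exI[of _ "Q / (2 * N)"]) auto
qed

lemma list_mat_mult_vec:
  fixes f :: "'a \<Rightarrow> 'a \<Rightarrow> 'k :: comm_ring_1"
  assumes "distinct vs" "i < length vs"
  shows "(list_mat vs vs f *\<^sub>v vec (length vs) (\<lambda>j. x (vs ! j))) $ i = (\<Sum>w\<in>set vs. f (vs ! i) w * x w)"
proof -
  have "bij_betw (nth vs) {0..<length vs} (set vs)"
    using assms by (intro bij_betw_nth) auto
  from sum.reindex_bij_betw[OF this, of "\<lambda>k. f (vs ! i) k * x k"] assms(2)
  show ?thesis by (simp add: list_mat_def scalar_prod_def)
qed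

lemma eigenvalue_laplacian_nonneg:
  assumes "pair_graph G" "enumerates vs G"
    and "eigenvalue (map_mat complex_of_real (laplacian_mat vs G)) z"
  shows "\<exists>c\<ge>0. z = complex_of_real c"
proof -
  have vs: "distinct vs" "set vs = pverts G" using assms(2) by (auto simp: enumerates_def)
  have L: "map_mat complex_of_real (laplacian_mat vs G) = list_mat vs vs (lap G)"
    unfolding laplacian_mat_eq_list_mat[OF vs(1)]
    by (rule eq_matI) (simp_all add: list_mat_def lap_def)
  obtain y where y: "y \<in> carrier_vec (length vs)" "y \<noteq> 0\<^sub>v (length vs)"
    "list_mat vs vs (lap G) *\<^sub>v y = z \<cdot>\<^sub>v y"
    using assms(3) unfolding L eigenvalue_def eigenvector_def by (auto simp: list_mat_def)
  \<comment> \<open>\<open>x\<close> is \<open>y\<close> read as a function on vertices: a vertex is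
    sent to its position in \<open>vs\<close>, and \<open>y\<close> is read there.\<close>
  define x where "x u = y $ (inv_into {..<length vs} (nth vs) u)" for u
  have x: "x (vs ! i) = y $ i" if "i < length vs" for i
    unfolding x_def using that vs(1) by (subst inv_into_f_f) (auto simp: inj_on_nth)
  then have yx: "y = vec (length vs) (\<lambda>j. x (vs ! j))"
    using y(1) by (intro eq_vecI) auto
  obtain i where i: "i < length vs" "y $ i \<noteq> 0"
    using y(1,2) by (metis carrier_vecD eq_vecI index_zero_vec)
  show ?thesis
  proof (rule lap_eigenvalue_nonneg[OF assms(1)])
    fix u assume "u \<in> pverts G"
    then obtain j where j: "j < length vs" "u = vs ! j"
      using vs(2) by (metis in_set_conv_nth)
    have "(\<Sum>w\<in>set vs. lap G (vs ! j) w * x w) = (list_mat vs vs (lap G) *\<^sub>v y) $ j"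
      by (subst yx) (rule list_mat_mult_vec[OF vs(1) j(1), symmetric])
    also have "\<dots> = z * x u"
      using y(1) j x[OF j(1)] by (simp add: y(3))
    finally show "(\<Sum>w\<in>pverts G. lap G u w * x w) = z * x u"
      using vs(2) j(2) by simp
  next
    show "vs ! i \<in> pverts G" using nth_mem[OF i(1)] vs(2) by simp
    show "x (vs ! i) \<noteq> 0" using i x by simp
  qed
qed

text \<open>Over the complex numbers the characteristic polynomial splits, and every root is an
  eigenvalue, hence real and nonnegative. Real polynomials embed injectively into complex ones, so
  the factorisation descends.\<close>

lemma char_poly_laplacian_factors:
  assumes "pair_graph G" "enumerates vs G"
  obtains rs where "char_poly (laplacian_mat vs G) = (\<Prod>r\<leftarrow>rs. [:- r, 1:])"
    "length rs = length vs" "\<And>r. r \<in> set rs \<Longrightarrow> r \<ge> 0"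
proof -
  let ?L = "laplacian_mat vs G"
  have L: "?L \<in> carrier_mat (length vs) (length vs)"
    by (auto simp: laplacian_mat_def degree_mat_def adjacency_mat_def)
  then have LC: "map_mat complex_of_real ?L \<in> carrier_mat (length vs) (length vs)" by simp
  obtain as where as: "char_poly (map_mat complex_of_real ?L) = (\<Prod>a\<leftarrow>as. [:- a, 1:])"
    "length as = length vs"
    using char_poly_factorized[OF LC] by blast
  have "\<exists>c\<ge>0. a = complex_of_real c" if "a \<in> set as" for a
  proof (rule eigenvalue_laplacian_nonneg[OF assms])
    have "poly (char_poly (map_mat complex_of_real ?L)) a = 0"
      using that unfolding as(1) by (auto simp: poly_prod_list prod_list_zero_iff image_iff)
    then show "eigenvalue (map_mat complex_of_real ?L) a"
      using eigenvalue_root_char_poly[OF LC] by simp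
  qed
  then have re: "Re a \<ge> 0 \<and> complex_of_real (Re a) = a" if "a \<in> set as" for a
    using that by fastforce
  define rs where "rs = map Re as"
  interpret h: map_poly_inj_comm_ring_hom complex_of_real ..
  have "map_poly complex_of_real (char_poly ?L) = (\<Prod>a\<leftarrow>as. [:- a, 1:])"
    using as(1) of_real_hom.char_poly_hom[OF L, where 'a = complex] by simp
  also have "\<dots> = map_poly complex_of_real (\<Prod>r\<leftarrow>rs. [:- r, 1:])"
    unfolding h.hom_prod_list rs_def map_map
    by (rule arg_cong[where f = prod_list], rule map_cong) (simp_all add: re)
  finally have "char_poly ?L = (\<Prod>r\<leftarrow>rs. [:- r, 1:])"
    by (simp only: h.eq_iff)
  then show ?thesis
    using as(2) re by (intro that[of rs]) (auto simp: rs_def)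
qed

text \<open>The linear factors determine the root multiset whose sorted list
  \<open>laplacian_eig\<close> reads. For the second claim, the all-ones vector lies in the kernel,
  so 0 is a root, and as no root is negative it heads the sorted list.\<close>

lemma char_poly_laplacian_eig:
  assumes "pair_graph G" "enumerates vs G"
  shows "char_poly (laplacian_mat vs G) = (\<Prod>i = 1..length vs. [:- laplacian_eig vs G i, 1:])"
    and "vs \<noteq> [] \<Longrightarrow> laplacian_eig vs G 1 = 0"
proof -
  obtain rs where rs: "char_poly (laplacian_mat vs G) = (\<Prod>r\<leftarrow>rs. [:- r, 1:])"
    "length rs = length vs" "\<And>r. r \<in> set rs \<Longrightarrow> r \<ge> 0"
    using char_poly_laplacian_factors[OF assms] by blast
  have "proots (\<Prod>r\<leftarrow>rs. [:- r, 1:]) = mset rs"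
  proof (induction rs)
    case (Cons r rs)
    have "(\<Prod>r\<leftarrow>rs. [:- r, 1:]) \<noteq> 0" by (auto simp: prod_list_zero_iff)
    then show ?case using Cons proots_mult[of "[:- r, 1:]" "\<Prod>r\<leftarrow>rs. [:- r, 1:]"]
      by (simp del: mult_pCons_left)
  qed simp
  then have eig: "laplacian_eig vs G i = sort rs ! (i - 1)" for i
    by (simp add: laplacian_eig_def rs(1))
  \<comment> \<open>Eigenvalues count from 1 and list positions from 0, hence the shift by
    \<open>Suc\<close>.\<close>
  have "(\<Prod>i = 1..length vs. [:- laplacian_eig vs G i, 1:]) = (\<Prod>i<length vs. [:- (sort rs ! i), 1:])"
    unfolding eig by (rule prod.reindex_bij_witness[of _ Suc "\<lambda>i. i - 1"]) auto
  also have "\<dots> = (\<Prod>r\<leftarrow>sort rs. [:- r, 1:])"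
    by (simp add: prod.list_conv_set_nth rs(2) atLeast0LessThan)
  also have "\<dots> = (\<Prod>r\<leftarrow>rs. [:- r, 1:])"
    by (simp only: prod_mset_prod_list[symmetric] mset_map mset_sort)
  finally show "char_poly (laplacian_mat vs G) = (\<Prod>i = 1..length vs. [:- laplacian_eig vs G i, 1:])"
    using rs(1) by simp
  assume "vs \<noteq> []"
  have vs: "distinct vs" "set vs = pverts G" using assms(2) by (auto simp: enumerates_def)
  have rows: "(\<Sum>w\<in>pverts G. lap G u w) = (0 :: real)" if "u \<in> pverts G" for u
    using lap_mult_vec[OF assms(1) that, of "\<lambda>_. 1 :: real"] by (simp cong: if_cong)
  have "laplacian_mat vs G *\<^sub>v vec (length vs) (\<lambda>_. 1) = 0 \<cdot>\<^sub>v vec (length vs) (\<lambda>_. 1)"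
  proof (rule eq_vecI)
    fix i assume "i < dim_vec (0 \<cdot>\<^sub>v vec (length vs) (\<lambda>_. 1 :: real))"
    then have i: "i < length vs" by simp
    then show "(laplacian_mat vs G *\<^sub>v vec (length vs) (\<lambda>_. 1)) $ i =
        (0 \<cdot>\<^sub>v vec (length vs) (\<lambda>_. 1)) $ i"
      using list_mat_mult_vec[OF vs(1) i, of "lap G" "\<lambda>_. 1 :: real"]
        nth_mem[OF i] vs
      by (simp add: laplacian_mat_eq_list_mat rows)
  qed (simp add: laplacian_mat_eq_list_mat[OF vs(1)] list_mat_def)
  moreover have "vec (length vs) (\<lambda>_. 1 :: real) \<noteq> 0\<^sub>v (length vs)"
  proof
    assume "vec (length vs) (\<lambda>_. 1 :: real) = 0\<^sub>v (length vs)"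
    from arg_cong[OF this, of "\<lambda>v. v $ 0"] \<open>vs \<noteq> []\<close> show False by simp
  qed
  ultimately have "eigenvalue (laplacian_mat vs G) 0"
    unfolding eigenvalue_def eigenvector_def
    by (intro exI[of _ "vec (length vs) (\<lambda>_. 1)"])
       (simp add: laplacian_mat_eq_list_mat[OF vs(1)] list_mat_def)
  then have "poly (char_poly (laplacian_mat vs G)) 0 = 0"
    using eigenvalue_root_char_poly[of "laplacian_mat vs G" "length vs" 0]
    by (simp add: laplacian_mat_eq_list_mat[OF vs(1)])
  then have "poly (\<Prod>r\<leftarrow>rs. [:- r, 1:]) 0 = 0" by (simp only: rs(1))
  then have "0 \<in> set (sort rs)"
    by (auto simp: poly_prod_list prod_list_zero_iff)
  then obtain j where j: "j < length (sort rs)" "sort rs ! j = 0"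
    by (metis in_set_conv_nth)
  \<comment> \<open>The first entry of the sorted list is bounded above by the entry 0 at position
    \<open>j\<close>; being a root, it is also nonnegative.\<close>
  then have "sort rs ! 0 \<le> 0"
    using sorted_nth_mono[OF sorted_sort[of rs], of 0 j] by simp
  moreover have "sort rs ! 0 \<ge> 0"
  proof (rule rs(3))
    have "sort rs ! 0 \<in> set (sort rs)" using j(1) by (intro nth_mem) linarith
    then show "sort rs ! 0 \<in> set rs" by simp
  qed
  ultimately show "laplacian_eig vs G 1 = 0" by (simp add: eig)
qed

section \<open>The subdivision-edge corona\<close>

lemma uedges_card_2:
  assumes "pair_graph G" "e \<in> uedges G"
  shows "card e = 2"
proof -
  interpret pair_graph G by fact
  from assms(2) obtain u v where "e = {u, v}" "(u, v) \<in> parcs G" by (auto simp: uedges_def)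
  moreover have "u \<noteq> v" using pair_no_loops[OF calculation(2)] by simp
  ultimately show ?thesis by simp
qed

text \<open>Edges at \<open>v\<close> correspond to neighbours \<open>w\<close> through
  \<open>{v, w}\<close>. The count is a diagonal entry of \<open>R R\<^sup>T\<close>, and also gives
  the degree of an old vertex in the corona.\<close>

lemma card_incident_uedges:
  assumes "pair_graph G"
  shows "card {e \<in> uedges G. v \<in> e} = card {w. (v, w) \<in> parcs G}"
proof -
  interpret pair_graph G by fact
  have "{e \<in> uedges G. v \<in> e} = (\<lambda>w. {v, w}) ` {w. (v, w) \<in> parcs G}"
  proof (intro equalityI subsetI)
    fix e assume "e \<in> {e \<in> uedges G. v \<in> e}"
    then obtain a b where "e = {a, b}" "(a, b) \<in> parcs G" "v = a \<or> v = b"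
      by (auto simp: uedges_def)
    then show "e \<in> (\<lambda>w. {v, w}) ` {w. (v, w) \<in> parcs G}"
      using arcs_symmetric[of a b] by (auto simp: insert_commute)
  qed (auto simp: uedges_def)
  moreover have "inj_on (\<lambda>w. {v, w}) {w. (v, w) \<in> parcs G}"
    by (auto simp: inj_on_def doubleton_eq_iff)
  ultimately show ?thesis by (simp add: card_image)
qed

text \<open>These are the off-diagonal entries of \<open>R R\<^sup>T\<close>: in a simple graph only
  the edge \<open>{v, w}\<close> can contain both vertices.\<close>

lemma card_uedges_joining:
  assumes "pair_graph G" "v \<noteq> w"
  shows "card {e \<in> uedges G. v \<in> e \<and> w \<in> e} = (if (v, w) \<in> parcs G then 1 else 0)"
proof -
  interpret pair_graph G by fact
  have "{e \<in> uedges G. v \<in> e \<and> w \<in> e} = (if (v, w) \<in> parcs G then {{v, w}} else {})"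
    using assms(2) arcs_symmetric[of w v] by (auto simp: uedges_def)
  then show ?thesis by simp
qed

section \<open>The characteristic matrix of the corona, block by block\<close>

context
  fixes G1 :: "'a pair_pre_digraph" and G2 :: "'b pair_pre_digraph"
  assumes G1: "pair_graph G1" and G2: "pair_graph G2"
begin

text \<open>An adjacency table by kinds of vertices: \<open>Inl (Inl v)\<close> is old,
  \<open>Inl (Inr e)\<close> is inserted, and \<open>Inr (w, u)\<close> lies in a copy. It replaces
  unfolding the set comprehensions in all later degree and entry computations.\<close>

lemma parcs_corona [simp]:
  "(Inl (Inl v), Inl (Inl v')) \<notin> parcs (subdivision_edge_corona G1 G2)"
  "(Inl (Inl v), Inl (Inr e)) \<in> parcs (subdivision_edge_corona G1 G2) \<longleftrightarrow> e \<in> uedges G1 \<and> v \<in> e"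
  "(Inl (Inr e), Inl (Inl v)) \<in> parcs (subdivision_edge_corona G1 G2) \<longleftrightarrow> e \<in> uedges G1 \<and> v \<in> e"
  "(Inl (Inr e), Inl (Inr e')) \<notin> parcs (subdivision_edge_corona G1 G2)"
  "(Inl (Inl v), Inr p) \<notin> parcs (subdivision_edge_corona G1 G2)"
  "(Inr p, Inl (Inl v)) \<notin> parcs (subdivision_edge_corona G1 G2)"
  "(Inl (Inr e), Inr (w, u)) \<in> parcs (subdivision_edge_corona G1 G2) \<longleftrightarrow>
     w = Inr e \<and> e \<in> uedges G1 \<and> u \<in> pverts G2"
  "(Inr (w, u), Inl (Inr e)) \<in> parcs (subdivision_edge_corona G1 G2) \<longleftrightarrow>
     w = Inr e \<and> e \<in> uedges G1 \<and> u \<in> pverts G2"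
  "(Inr (w, u), Inr (w', u')) \<in> parcs (subdivision_edge_corona G1 G2) \<longleftrightarrow>
     w = w' \<and> w \<in> Inr ` uedges G1 \<and> (u, u') \<in> parcs G2"
  by (auto simp: subdivision_edge_corona_def subdivision_graph_def inserted_vertices_def)

lemma degree_corona_old:
  "card {w. (Inl (Inl v), w) \<in> parcs (subdivision_edge_corona G1 G2)} = card {w. (v, w) \<in> parcs G1}"
proof -
  have "{w. (Inl (Inl v), w) \<in> parcs (subdivision_edge_corona G1 G2)} =
      (Inl \<circ> Inr) ` {e \<in> uedges G1. v \<in> e}"
  proof (rule Set.set_eqI)
    fix z :: "('a + 'a set) + ('a + 'a set) \<times> 'b"
    show "z \<in> {w. (Inl (Inl v), w) \<in> parcs (subdivision_edge_corona G1 G2)} \<longleftrightarrow>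
      z \<in> (Inl \<circ> Inr) ` {e \<in> uedges G1. v \<in> e}"
      \<comment> \<open>The two splits separate the three kinds of vertices; for a vertex in a copy
        \<open>projl z\<close> is unspecified and the second split is harmless.\<close>
      by (cases z; cases "projl z") auto
  qed
  then show ?thesis
    by (simp add: card_image inj_on_def card_incident_uedges[OF G1])
qed

lemma degree_corona_inserted:
  assumes "e \<in> uedges G1"
  shows "card {w. (Inl (Inr e), w) \<in> parcs (subdivision_edge_corona G1 G2)} = 2 + card (pverts G2)"
proof -
  interpret G2: pair_graph G2 by (rule G2)
  have "finite e" using uedges_card_2[OF G1 assms] by (metis card.infinite zero_neq_numeral)
  have "{w. (Inl (Inr e), w) \<in> parcs (subdivision_edge_corona G1 G2)} =
      (Inl \<circ> Inl) ` e \<union> (\<lambda>u. Inr (Inr e, u)) ` pverts G2"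
  proof (rule Set.set_eqI)
    fix z :: "('a + 'a set) + ('a + 'a set) \<times> 'b"
    show "z \<in> {w. (Inl (Inr e), w) \<in> parcs (subdivision_edge_corona G1 G2)} \<longleftrightarrow>
      z \<in> (Inl \<circ> Inl) ` e \<union> (\<lambda>u. Inr (Inr e, u)) ` pverts G2"
      using assms by (cases z; cases "projl z") auto
  qed
  moreover have "card ((Inl \<circ> Inl) ` e \<union> (\<lambda>u. Inr (Inr e, u)) ` pverts G2
      :: (('a + 'a set) + ('a + 'a set) \<times> 'b) set) = card e + card (pverts G2)"
    using \<open>finite e\<close> by (subst card_Un_disjoint) (auto simp: card_image inj_on_def)
  ultimately show ?thesis using uedges_card_2[OF G1 assms] by simp
qed

lemma degree_corona_copy:
  assumes "e \<in> uedges G1" "u \<in> pverts G2"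
  shows "card {w. (Inr (Inr e, u), w) \<in> parcs (subdivision_edge_corona G1 G2)} =
    1 + card {w. (u, w) \<in> parcs G2}"
proof -
  interpret G2: pair_graph G2 by (rule G2)
  have fin: "finite {w. (u, w) \<in> parcs G2}"
    by (rule finite_subset[OF _ G2.pair_finite_verts]) (auto dest: G2.in_arcsD2)
  have "{w. (Inr (Inr e, u), w) \<in> parcs (subdivision_edge_corona G1 G2)} =
      insert (Inl (Inr e)) ((\<lambda>w. Inr (Inr e, w)) ` {w. (u, w) \<in> parcs G2})"
  proof (rule Set.set_eqI)
    fix z :: "('a + 'a set) + ('a + 'a set) \<times> 'b"
    show "z \<in> {w. (Inr (Inr e, u), w) \<in> parcs (subdivision_edge_corona G1 G2)} \<longleftrightarrow>
      z \<in> insert (Inl (Inr e)) ((\<lambda>w. Inr (Inr e, w)) ` {w. (u, w) \<in> parcs G2})"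
      using assms by (cases z; cases "projl z") auto
  qed
  moreover have "card (insert (Inl (Inr e)) ((\<lambda>w. Inr (Inr e, w)) ` {w. (u, w) \<in> parcs G2})
      :: (('a + 'a set) + ('a + 'a set) \<times> 'b) set) = 1 + card {w. (u, w) \<in> parcs G2}"
    using fin by (subst card_insert_disjoint) (auto simp: card_image inj_on_def)
  ultimately show ?thesis by simp
qed

text \<open>Both eliminations of the overview are carried out at a point \<open>x\<close> of a field
  where the pivots \<open>x - 1\<close> and \<open>c\<close> are nonzero. The power of
  \<open>- 1 / c\<close> arises from rewriting what is left on the old vertices as a multiple of a
  characteristic matrix of \<open>G1\<close>.\<close>

lemma det_on_corona:
  fixes x :: "'k :: field"
  defines "c \<equiv> x - 2 - of_nat (card (pverts G2)) - of_nat (card (pverts G2)) / (x - 1)"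
  assumes reg: "regular_graph r G1" and x: "x \<noteq> 1" and c: "c \<noteq> 0"
  shows "det_on (pverts (subdivision_edge_corona G1 G2))
      (\<lambda>a b. (if a = b then x else 0) - lap (subdivision_edge_corona G1 G2) a b) =
    (- 1 / c) ^ card (pverts G1)
    * det_on (pverts G1) (\<lambda>a b. (if a = b then 2 * of_nat r - c * (x - of_nat r) else 0) - lap G1 a b)
    * c ^ card (uedges G1)
    * det_on (pverts G2) (\<lambda>a b. (if a = b then x - 1 else 0) - lap G2 a b) ^ card (uedges G1)"
proof -
  interpret G1: pair_graph G1 by (rule G1)
  interpret G2: pair_graph G2 by (rule G2)
  let ?K = "subdivision_edge_corona G1 G2"
  let ?V1 = "pverts G1" and ?V2 = "pverts G2" and ?R = "uedges G1"
  let ?n2 = "of_nat (card (pverts G2)) :: 'k"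
  have finR: "finite ?R" by (rule finite_uedges[OF G1])
  have degr: "card {w. (v, w) \<in> parcs G1} = r" if "v \<in> ?V1" for v
    using reg that by (simp add: regular_graph_def out_degree_with_proj)
  \<comment> \<open>Naming the three embeddings keeps the sum constructors folded, so that matrix
    entries are rewritten by kind of vertex.\<close>
  define old :: "'a \<Rightarrow> ('a + 'a set) + ('a + 'a set) \<times> 'b" where "old v = Inl (Inl v)" for v
  define ins :: "'a set \<Rightarrow> ('a + 'a set) + ('a + 'a set) \<times> 'b" where "ins e = Inl (Inr e)" for e
  define cop :: "'a set \<times> 'b \<Rightarrow> ('a + 'a set) + ('a + 'a set) \<times> 'b"
    where "cop p = Inr (Inr (fst p), snd p)" for p
  have [simp]: "old v \<noteq> ins e" "ins e \<noteq> old v" "old v \<noteq> cop p" "cop p \<noteq> old v" "ins e \<noteq> cop p"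
      "cop p \<noteq> ins e" "old v = old w \<longleftrightarrow> v = w" "ins e = ins e' \<longleftrightarrow> e = e'" "cop p = cop q \<longleftrightarrow> p = q"
    for v w e e' p q
    by (auto simp: old_def ins_def cop_def prod_eq_iff)
  have inj: "inj_on old X" "inj_on ins Y" "inj_on cop Z" for X Y Z
    by (auto simp: inj_on_def)
  define A where "A = old ` ?V1"
  define B where "B = ins ` ?R"
  define C where "C = cop ` (?R \<times> ?V2)"
  have fin: "finite A" "finite B" "finite C" "finite (A \<union> B)"
    using finR by (auto simp: A_def B_def C_def)
  have dis: "A \<inter> B = {}" "(A \<union> B) \<inter> C = {}"
    by (auto simp: A_def B_def C_def)
  have verts: "pverts ?K = (A \<union> B) \<union> C"
    by (auto simp: subdivision_edge_corona_def subdivision_graph_def inserted_vertices_def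
        A_def B_def C_def old_def ins_def cop_def image_iff)
  define f where "f a b = (if a = b then x else 0) - lap ?K a b" for a b
  have f_old_old: "f (old v) (old w) = (if v = w then x - of_nat r else 0)" if "v \<in> ?V1" for v w
    using that degree_corona_old[of v] degr[of v]
    by (simp add: f_def lap_def) (auto simp: old_def)
  have f_old_cop: "f (old v) (cop p) = 0" "f (cop p) (old v) = 0" for v p
    by (simp_all add: f_def lap_def) (simp_all add: old_def cop_def)
  \<comment> \<open>Off the diagonal, \<open>f\<close> equals plus the adjacency, since the
    Laplacian carries it with a minus sign.\<close>
  have f_old_ins: "f (old v) (ins e) = (if v \<in> e then 1 else 0)"
      "f (ins e) (old v) = (if v \<in> e then 1 else 0)"
    if "e \<in> ?R" for v e
    using that by (simp_all add: f_def lap_def) (simp_all add: old_def ins_def)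
  have f_ins_ins: "f (ins e) (ins e') = (if e = e' then x - 2 - ?n2 else 0)" if "e \<in> ?R" for e e'
    using that degree_corona_inserted[of e]
    by (simp add: f_def lap_def) (auto simp: ins_def)
  have f_ins_cop: "f (ins e) (cop (e', u)) = (if e = e' then 1 else 0)"
      "f (cop (e', u)) (ins e) = (if e = e' then 1 else 0)"
    if "e \<in> ?R" "u \<in> ?V2" for e e' u
    using that by (simp_all add: f_def lap_def) (auto simp: ins_def cop_def)
  \<comment> \<open>Joining a copy to its inserted vertex raises every degree in it by 1, which
    turns \<open>x\<close> into \<open>x - 1\<close>.\<close>
  have f_cop: "f (cop (e, u)) (cop (e', u')) =
      (if e = e' then (if u = u' then x - 1 else 0) - lap G2 u u' else 0)"
    if "e \<in> ?R" "u \<in> ?V2" for e e' u u'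
    using that degree_corona_copy[of e u]
    by (cases "e = e'"; cases "u = u'") (auto simp: f_def lap_def cop_def)
  have sum_C: "(\<Sum>k\<in>C. h k) = (\<Sum>e\<in>?R. \<Sum>u\<in>?V2. h (cop (e, u)))" for h :: "_ \<Rightarrow> 'k"
    unfolding C_def by (subst sum.reindex[OF inj(3)]) (simp add: sum.cartesian_product)
  have x1: "x - 1 \<noteq> 0" using x by simp
  \<comment> \<open>The column of an inserted vertex is all ones on its own copy and 0 on the
    others. The block of a copy maps the all-ones vector to \<open>x - 1\<close> times itself
    (\<open>row2'\<close>), so the coefficients \<open>1 / (x - 1)\<close> on that copy reproduce
    the column.\<close>
  define W where "W k s = (case (k, s) of (Inr (w, u), Inl w') \<Rightarrow> if w = w' then 1 / (x - 1) else 0 | _ \<Rightarrow> 0)"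
    for k s :: "('a + 'a set) + ('a + 'a set) \<times> 'b"
  have W: "W (cop p) (old v) = 0" "W (cop (e, u)) (ins e') = (if e = e' then 1 / (x - 1) else 0)"
    for p v e u e'
    by (auto simp: W_def cop_def old_def ins_def)
  have row2: "(\<Sum>w\<in>?V2. lap G2 u w) = (0 :: 'k)" if "u \<in> ?V2" for u
    using lap_mult_vec[OF G2 that, of "\<lambda>_. 1 :: 'k"] by (simp cong: if_cong)
  have row2': "(\<Sum>w\<in>?V2. (if u = w then x - 1 else 0) - lap G2 u w) = x - 1" if "u \<in> ?V2" for u
    using that by (simp add: sum_subtractf row2)
  have W_sum: "(\<Sum>k\<in>C. f a k * W k (ins e)) = (\<Sum>u\<in>?V2. f a (cop (e, u))) / (x - 1)"
    if "e \<in> ?R" for a e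
  proof -
    have "(\<Sum>k\<in>C. f a k * W k (ins e)) =
        (\<Sum>e'\<in>?R. if e' = e then (\<Sum>u\<in>?V2. f a (cop (e', u))) / (x - 1) else 0)"
      unfolding sum_C by (intro sum.cong refl) (simp add: W sum_divide_distrib)
    then show ?thesis using that finR by simp
  qed
  \<comment> \<open>\<open>g\<close> is the Schur complement after eliminating the copies. It
    differs from \<open>f\<close> only at the diagonal entries of inserted vertices, which drop by
    \<open>?n2 / (x - 1)\<close> to \<open>c\<close>.\<close>
  define g where "g a b = f a b - (\<Sum>k\<in>C. f a k * W k b)" for a b
  have 1: "det_on (pverts ?K) f = det_on (A \<union> B) g * det_on C f"
    unfolding verts g_def
  proof (rule det_on_schur[OF fin(4,3) dis(2)])
    fix t s assume "t \<in> C" "s \<in> A \<union> B"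
    then obtain e u where t: "t = cop (e, u)" "e \<in> ?R" "u \<in> ?V2" by (auto simp: C_def)
    from \<open>s \<in> A \<union> B\<close> show "f t s = (\<Sum>k\<in>C. f t k * W k s)"
    proof
      assume "s \<in> A"
      then show ?thesis using t by (auto simp: A_def sum_C W f_old_cop)
    next
      assume "s \<in> B"
      then obtain e' where e': "s = ins e'" "e' \<in> ?R" by (auto simp: B_def)
      have "(\<Sum>w\<in>?V2. f t (cop (e', w))) = (if e = e' then x - 1 else 0)"
        using t row2'[OF t(3)] by (simp add: f_cop)
      then show ?thesis using t e'(1,2) x1  by (simp add: W_sum f_ins_cop)
    qed
  qed
  have g_old_old: "g (old v) (old w) = (if v = w then x - of_nat r else 0)" if "v \<in> ?V1" for v w
    using that by (simp add: g_def sum_C W f_old_old)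
  have g_old_ins: "g (old v) (ins e) = (if v \<in> e then 1 else 0)"
      "g (ins e) (old v) = (if v \<in> e then 1 else 0)"
    if "e \<in> ?R" for v e
    using that by (simp_all add: g_def W_sum f_old_ins f_old_cop) (simp_all add: sum_C W)
  have g_ins: "g (ins e) (ins e') = (if e = e' then c else 0)" if "e \<in> ?R" "e' \<in> ?R" for e e'
    using that x1 by (simp add: g_def W_sum f_ins_ins f_ins_cop c_def)
  \<comment> \<open>The block of inserted vertices is now \<open>c\<close> times the identity, so
    the coefficients are the transposed incidence matrix divided by \<open>c\<close>.\<close>
  define Z where "Z k s = (case (k, s) of (Inl (Inr e), Inl (Inl v)) \<Rightarrow> if v \<in> e then 1 / c else 0 | _ \<Rightarrow> 0)"
    for k s :: "('a + 'a set) + ('a + 'a set) \<times> 'b"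
  have Z: "Z (ins e) (old v) = (if v \<in> e then 1 / c else 0)" for e v
    by (simp add: Z_def ins_def old_def)
  have sum_B: "(\<Sum>k\<in>B. h k) = (\<Sum>e\<in>?R. h (ins e))" for h :: "_ \<Rightarrow> 'k"
    unfolding B_def by (subst sum.reindex[OF inj(2)]) simp
  have 2: "det_on (A \<union> B) g = det_on A (\<lambda>a b. g a b - (\<Sum>k\<in>B. g a k * Z k b)) * det_on B g"
  proof (rule det_on_schur[OF fin(1,2) dis(1)])
    fix t s assume "t \<in> B" "s \<in> A"
    then obtain e v where ev: "t = ins e" "e \<in> ?R" "s = old v" "v \<in> ?V1" by (auto simp: A_def B_def)
    have "(\<Sum>k\<in>B. g t k * Z k s) = (\<Sum>e'\<in>?R. if e = e' then if v \<in> e' then 1 else 0 else 0)"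
      unfolding sum_B using ev c by (intro sum.cong refl) (simp add: g_ins Z)
    then show "g t s = (\<Sum>k\<in>B. g t k * Z k s)"
      using ev finR by (simp add: g_old_ins)
  qed
  \<comment> \<open>Substituting \<open>R R\<^sup>T\<close> as \<open>2 r I - L(G1)\<close> into
    \<open>(x - r) I - R R\<^sup>T / c\<close> gives \<open>(- 1 / c) (y I - L(G1))\<close> with
    this \<open>y\<close>.\<close>
  define y where "y = 2 * of_nat r - c * (x - of_nat r)"
  have "det_on A (\<lambda>a b. g a b - (\<Sum>k\<in>B. g a k * Z k b)) =
      det_on ?V1 (\<lambda>v w. g (old v) (old w) - (\<Sum>k\<in>B. g (old v) k * Z k (old w)))"
    unfolding A_def by (rule det_on_reindex) (simp_all add: inj)
  also have "\<dots> = det_on ?V1 (\<lambda>v w. (- 1 / c) * ((if v = w then y else 0) - lap G1 v w))"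
  proof (rule det_on_cong)
    fix v w assume vw: "v \<in> ?V1" "w \<in> ?V1"
    have "(\<Sum>k\<in>B. g (old v) k * Z k (old w)) = (\<Sum>e\<in>?R. if v \<in> e \<and> w \<in> e then 1 / c else 0)"
      unfolding sum_B using vw by (intro sum.cong refl) (simp add: g_old_ins Z)
    also have "\<dots> = of_nat (card {e \<in> ?R. v \<in> e \<and> w \<in> e}) / c"
      using finR by (simp add: sum.If_cases Int_def)
    finally have eq: "(\<Sum>k\<in>B. g (old v) k * Z k (old w)) = of_nat (card {e \<in> ?R. v \<in> e \<and> w \<in> e}) / c" .
    show "g (old v) (old w) - (\<Sum>k\<in>B. g (old v) k * Z k (old w)) =
        (- 1 / c) * ((if v = w then y else 0) - lap G1 v w)"
    proof (cases "v = w")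
      case True
      moreover have "(w, w) \<notin> parcs G1" using G1.pair_no_loops by fastforce
      ultimately show ?thesis
        unfolding eq g_old_old[OF vw(1)] using vw c card_incident_uedges[OF G1, of w] degr[of w]
        by (simp add: lap_def y_def field_simps)
    next
      case False
      then show ?thesis
        unfolding eq g_old_old[OF vw(1)] using c card_uedges_joining[OF G1 False] by (simp add: lap_def)
    qed
  qed simp
  also have "\<dots> = (- 1 / c) ^ card ?V1 * det_on ?V1 (\<lambda>v w. (if v = w then y else 0) - lap G1 v w)"
    by (rule det_on_scale) simp
  finally have 3: "det_on A (\<lambda>a b. g a b - (\<Sum>k\<in>B. g a k * Z k b)) =
    (- 1 / c) ^ card ?V1 * det_on ?V1 (\<lambda>v w. (if v = w then y else 0) - lap G1 v w)" .
  have "det_on B g = det_on B (\<lambda>a b. if a = b then c else 0)"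
    using fin(2) by (rule det_on_cong) (auto simp: B_def g_ins)
  then have 4: "det_on B g = c ^ card ?R"
    using det_on_diag[OF fin(2), of "\<lambda>_. c"] card_image[OF inj(2), of ?R] by (simp add: B_def)
  have "det_on C f = det_on (?R \<times> ?V2) (\<lambda>p q. f (cop p) (cop q))"
    unfolding C_def using finR by (intro det_on_reindex) (simp_all add: inj)
  also have "\<dots> = det_on (?R \<times> ?V2) (\<lambda>p q. if fst p = fst q
      then (if snd p = snd q then x - 1 else 0) - lap G2 (snd p) (snd q) else 0)"
  proof (rule det_on_cong)
    fix p q assume "p \<in> ?R \<times> ?V2" "q \<in> ?R \<times> ?V2"
    then show "f (cop p) (cop q) = (if fst p = fst q
        then (if snd p = snd q then x - 1 else 0) - lap G2 (snd p) (snd q) else 0)"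
      using f_cop[of "fst p" "snd p" "fst q" "snd q"] by (simp add: mem_Times_iff)
  qed (simp add: finR)
  also have "\<dots> = det_on ?V2 (\<lambda>u w. (if u = w then x - 1 else 0) - lap G2 u w) ^ card ?R"
    by (rule det_on_block_diag[OF finR, of ?V2 "\<lambda>u w. (if u = w then x - 1 else 0) - lap G2 u w"]) simp
  finally show ?thesis
    unfolding f_def[abs_def, symmetric] y_def[symmetric] using 1 2 3 4 by simp
qed

end

section \<open>Evaluation of the spectra at rational functions and assembly of the formula\<close>

lemma hom_prod_linear:
  fixes \<phi> :: "'r :: comm_ring_1 poly \<Rightarrow> 'k :: comm_ring_1"
  assumes "comm_ring_hom \<phi>"
  shows "\<phi> (\<Prod>i\<in>I. [:- \<mu> i, 1:]) = (\<Prod>i\<in>I. \<phi> [:0, 1:] - \<phi> [:\<mu> i:])"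
proof -
  interpret comm_ring_hom \<phi> by fact
  have "\<phi> [:- m, 1:] = \<phi> [:0, 1:] - \<phi> [:m:]" for m
    using hom_minus[of "[:0, 1:]" "[:m:]"] by simp
  then show ?thesis by (simp add: hom_prod)
qed

text \<open>Mapping coefficients by \<open>h\<close> and then evaluating at \<open>y\<close> is a
  ring homomorphism on real polynomials, so the real factorisation of the characteristic polynomial
  can be evaluated at any \<open>y\<close> of the target ring.\<close>

lemma det_on_lap_eig:
  fixes h :: "real \<Rightarrow> 'k :: comm_ring_1"
  assumes "comm_ring_hom h" "pair_graph G" "enumerates us G"
  shows "det_on (pverts G) (\<lambda>a b. (if a = b then y else 0) - lap G a b) =
    (\<Prod>i = 1..card (pverts G). y - h (laplacian_eig us G i))"
proof -
  interpret h: comm_ring_hom h by fact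
  interpret hp: map_poly_comm_ring_hom h ..
  have hom_eval: "comm_ring_hom (\<lambda>p. poly (map_poly h p) y)"
    by standard (simp_all add: hp.hom_add hp.hom_mult)
  have us: "distinct us" "set us = pverts G" using assms(3) by (auto simp: enumerates_def)
  then have "card (pverts G) = length us" by (metis distinct_card)
  then show ?thesis
    using hom_char_poly_laplacian[OF hom_eval us(1), of G] us(2)
      hom_prod_linear[OF hom_eval, of "laplacian_eig us G" "{1..length us}"]
    by (simp add: char_poly_laplacian_eig(1)[OF assms(2,3)] h.map_poly_pCons_hom cong: if_cong)
qed

theorem theorem3p7:
  fixes G1 :: "'a pair_pre_digraph" and G2 :: "'b pair_pre_digraph"
    and r1 n1 m1 n2 :: nat
    and vs1 :: "'a list" and vs2 :: "'b list"
    and vs :: "(('a + 'a set) + ('a + 'a set) \<times> 'b) list"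
  assumes "pair_graph G1" and "regular_graph r1 G1"
    and "card (pverts G1) = n1" and "card (uedges G1) = m1"
    and "pair_graph G2" and "card (pverts G2) = n2" and "n2 \<ge> 1"
    and "enumerates vs1 G1" and "enumerates vs2 G2"
    and "enumerates vs (subdivision_edge_corona G1 G2)"
  shows "to_fract (char_poly (laplacian_mat vs (subdivision_edge_corona G1 G2))) =
    to_fract [:2, - (3 + real n2), 1:] powi (int m1 - int n1)
    * to_fract (\<Prod>i = 2..n2. [:- 1 - laplacian_eig vs2 G2 i, 1:] ^ m1)
    * to_fract (\<Prod>i = 1..n1.
        [:- laplacian_eig vs1 G1 i,
          2 + real r1 + real r1 * real n2 + laplacian_eig vs1 G1 i,
          - (3 + real r1 + real n2),
          1:])"
proof -
  let ?K = "subdivision_edge_corona G1 G2"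
  let ?\<mu>1 = "laplacian_eig vs1 G1" and ?\<mu>2 = "laplacian_eig vs2 G2"
  have vs: "distinct vs" "set vs = pverts ?K" and vs2: "set vs2 = pverts G2"
    using assms(9,10) by (auto simp: enumerates_def)
  \<comment> \<open>\<open>h\<close> embeds the reals as constant rational functions and
    \<open>x\<close> below is the indeterminate. A field is needed for the pivots
    \<open>x - 1\<close> and \<open>c\<close>, and for the exponent \<open>int m1 - int n1\<close>,
    which may be negative.\<close>
  define h :: "real \<Rightarrow> real poly fract" where "h a = to_fract [:a:]" for a
  interpret h: comm_ring_hom h
    by standard (simp_all add: h_def one_pCons[symmetric] flip: to_fract_add to_fract_mult)
  interpret tf: comm_ring_hom "to_fract :: real poly \<Rightarrow> real poly fract"
    by standard simp_all
  define x where "x = to_fract [:0, 1 :: real:]"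
  have pCons: "to_fract (pCons a p) = h a + x * to_fract p" for a p
    by (simp add: h_def x_def flip: to_fract_add to_fract_mult)
  have h_nat: "h (real n) = of_nat n" for n by (rule h.hom_of_nat)
  define c where "c = x - 2 - of_nat n2 - of_nat n2 / (x - 1)"
  define q where "q = to_fract [:2, - (3 + real n2), 1:]"
  have x1: "x - 1 \<noteq> 0"
    by (simp add: x_def one_pCons flip: to_fract_1 to_fract_diff)
  have q: "q = x\<^sup>2 - (3 + of_nat n2) * x + 2"
    using h.hom_of_nat[of 2] h.hom_of_nat[of 3]
    by (simp add: q_def pCons h.hom_add h.hom_minus h.hom_uminus h_nat h.hom_one algebra_simps power2_eq_square)
  have q0: "q \<noteq> 0" by (simp add: q_def)
  have cq: "c * (x - 1) = q"
    using x1 by (simp add: c_def q field_simps power2_eq_square)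
  then have c0: "c \<noteq> 0" using q0 by auto
  \<comment> \<open>As \<open>q / c = x - 1\<close>, multiplication by \<open>q\<close> clears the
    denominator \<open>c\<close> in the factor of an eigenvalue \<open>m\<close>. Doing so for all
    \<open>n1\<close> factors costs \<open>q ^ n1\<close>, which accounts for the
    \<open>- n1\<close> in the exponent.\<close>
  have cubic: "to_fract [:- m, 2 + real r1 + real r1 * real n2 + m, - (3 + real r1 + real n2), 1:] =
      q * ((- 1 / c) * (2 * of_nat r1 - c * (x - of_nat r1) - h m))" for m
  proof -
    have "q * ((- 1 / c) * (2 * of_nat r1 - c * (x - of_nat r1) - h m)) =
        (x - 1) * (h m - 2 * of_nat r1) + q * (x - of_nat r1)"
      using c0 by (simp flip: cq add: field_simps)
    also have "\<dots> = to_fract [:- m, 2 + real r1 + real r1 * real n2 + m, - (3 + real r1 + real n2), 1:]"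
      using h.hom_of_nat[of 2] h.hom_of_nat[of 3]
      by (simp add: q pCons h.hom_add h.hom_minus h.hom_uminus h.hom_mult h_nat h.hom_one algebra_simps
          power2_eq_square)
    finally show ?thesis by simp
  qed
  have "vs2 \<noteq> []" using vs2 assms(6,7) by auto
  then have \<mu>2_1: "?\<mu>2 1 = 0" by (rule char_poly_laplacian_eig(2)[OF assms(5,9)])
  have "to_fract (char_poly (laplacian_mat vs ?K)) =
      det_on (pverts ?K) (\<lambda>a b. (if a = b then x else 0) - lap ?K a b)"
    using hom_char_poly_laplacian[OF tf.comm_ring_hom_axioms vs(1), of ?K] unfolding x_def vs(2) .
  also have "\<dots> = (- 1 / c) ^ n1 * (\<Prod>i = 1..n1. 2 * of_nat r1 - c * (x - of_nat r1) - h (?\<mu>1 i))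
      * c ^ m1 * (\<Prod>i = 1..n2. x - 1 - h (?\<mu>2 i)) ^ m1"
    using det_on_corona[OF assms(1,5,2), of x] x1 c0 
      det_on_lap_eig[OF h.comm_ring_hom_axioms assms(1,8)]
      det_on_lap_eig[OF h.comm_ring_hom_axioms assms(5,9)]
    by (simp add: assms(3,4,6) c_def)
  \<comment> \<open>The eigenvalue 0 of \<open>G2\<close> contributes the factor
    \<open>x - 1\<close>; since \<open>n2 \<ge> 1\<close>, it can be split off the product.\<close>
  also have "(\<Prod>i = 1..n2. x - 1 - h (?\<mu>2 i)) = (x - 1) * (\<Prod>i = 2..n2. x - 1 - h (?\<mu>2 i))"
    (is "_ = _ * ?Q")
    using assms(7) \<mu>2_1 by (simp add: prod.atLeast_Suc_atMost numeral_2_eq_2)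
  also have "(- 1 / c) ^ n1 * (\<Prod>i = 1..n1. 2 * of_nat r1 - c * (x - of_nat r1) - h (?\<mu>1 i)) =
      (\<Prod>i = 1..n1. (- 1 / c) * (2 * of_nat r1 - c * (x - of_nat r1) - h (?\<mu>1 i)))"
    (is "_ = ?P")
    by (simp only: prod.distrib prod_constant card_atLeastAtMost) simp
  finally have "to_fract (char_poly (laplacian_mat vs ?K)) = ?P * c ^ m1 * ((x - 1) * ?Q) ^ m1" .
  moreover have "to_fract (\<Prod>i = 1..n1. [:- ?\<mu>1 i, 2 + real r1 + real r1 * real n2 + ?\<mu>1 i,
      - (3 + real r1 + real n2), 1:]) = q ^ n1 * ?P"
    unfolding tf.hom_prod cubic by (simp only: prod.distrib prod_constant card_atLeastAtMost) simp
  moreover have "to_fract (\<Prod>i = 2..n2. [:- 1 - ?\<mu>2 i, 1:] ^ m1) = ?Q ^ m1"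
  proof -
    have "to_fract [:- 1 - m, 1:] = x - 1 - h m" for m
      by (simp add: pCons h.hom_minus h.hom_uminus h.hom_one algebra_simps)
    then show ?thesis
      by (simp only: tf.hom_prod tf.hom_power prod_power_distrib)
  qed
  moreover have "q powi (int m1 - int n1) = q ^ m1 / q ^ n1"
    using q0 by (simp add: power_int_diff)
  \<comment> \<open>The \<open>m1\<close> pivots \<open>c\<close> and the factors
    \<open>x - 1\<close> split off from the \<open>m1\<close> copies pair up to
    \<open>q ^ m1\<close>; the remaining \<open>q ^ n1\<close> cancels against the cubics.\<close>
  moreover have "q ^ m1 = c ^ m1 * (x - 1) ^ m1"
    by (simp flip: cq add: power_mult_distrib)
  ultimately show ?thesis
    using q0 unfolding q_def[symmetric] by (simp add: power_mult_distrib)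
qed

end
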